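(* Let $\mathbb C^*=\mathbb C\setminus\{0\}$ and regard $(\mathbb C^* )^2\subset\mathbb C^2\subset\mathbb P^2(\mathbb C)$ via $(z_1,z_2)\mapsto[1:z_1:z_2]$. Let $ds^2_{FS}$ be the Fubini–Study metric on $\mathbb P^2(\mathbb C)$. Then $(\mathbb C^* )^2$ is not of $ds^2_{FS}$-limit type.
   Context: $\Delta$ is the open unit disc in $\mathbb C$, and $\mathrm{Hol}(X,Y)$ is the set of holomorphic maps $X\to Y$. For a domain $X\subset\mathbb P^n(\mathbb C)$, a holomorphic curve $f:\mathbb C\to X$ is a $ds^2_{FS}$-Brody curve if the Fubini–Study length of its derivative $f'(z)$ is bounded on $\mathbb C$. A family $\mathcal F\subset\mathrm{Hol}(X,Y)$ is normal if it is relatively compact in $\mathrm{Hol}(X,Y)$ in the compact-open topology. A sequence $\{f_j\}\subset \mathcal F$ is compactly divergent if for all compact sets $K\subset X$ and $L\subset Y$ there is $j_0$ with $f_j(K)\cap L=\emptyset$ for all $j\ge j_0$. A family $\mathcal F$ is not compactly divergent if it contains no compactly divergent sequence. $X$ is of $ds^2_{FS}$-limit type if: for each family $\mathcal F\subset\mathrm{Hol}(\Delta,X)$ that is not normal and is not compactly divergent, there exist sequences $\{p_j\}\subset\Delta$ with $p_j\to p_0\in\Delta$, $\{f_j\}\subset\mathcal F$, and $\rho_j>0$ with $\rho_j\to0^+$, such that $g_j(\xi):=f_j(p_j+\rho_j\xi)$ converges uniformly on compact subsets of $\mathbb C$ to a non-constant $ds^2_{FS}$-Brody curve $g:\mathbb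 C\to X$. (Each $g_j$ is defined where $p_j+\rho_j\xi\in\Delta$; any given compact subset of $\mathbb C$ lies in its domain for all large $j$.) *)

theory Defs
  imports "HOL-Complex_Analysis.Complex_Analysis"
begin

section \<open>The standard Hermitian form\<close>

definition herm :: "complex ^ 'n \<Rightarrow> complex ^ 'n \<Rightarrow> complex" where
  "herm v w = (\<Sum>i\<in>UNIV. v $ i * cnj (w $ i))"

lemma herm_add_left: "herm (u + v) w = herm u w + herm v w"
  by (simp add: herm_def distrib_right sum.distrib)

lemma herm_add_right: "herm w (u + v) = herm w u + herm w v"
  by (simp add: herm_def distrib_left sum.distrib)

lemma herm_scale_left: "herm (c *s v) w = c * herm v w"
  by (simp add: herm_def sum_distrib_left mult.assoc)

lemma herm_scale_right: "herm v (c *s w) = cnj c * herm v w"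
  by (simp add: herm_def sum_distrib_left algebra_simps)

lemma cnj_herm: "cnj (herm v w) = herm w v"
  by (simp add: herm_def mult.commute)

lemma Re_herm: "Re (herm v w) = v \<bullet> w"
  by (simp add: herm_def inner_vec_def inner_complex_def)

lemma herm_self: "herm v v = complex_of_real ((norm v)\<^sup>2)"
proof -
  have "Im (herm v v) = 0"
    by (simp add: herm_def mult.commute)
  then show ?thesis
    by (simp add: complex_eq_iff Re_herm power2_norm_eq_inner)
qed

lemma norm_cscale: "norm (c *s (v :: complex ^ 'n)) = cmod c * norm v"
proof -
  have "complex_of_real ((norm (c *s v))\<^sup>2) = complex_of_real ((cmod c * norm v)\<^sup>2)"
    by (simp only: herm_self [symmetric] herm_scale_left herm_scale_right)
      (simp add: herm_self power_mult_distrib complex_norm_square mult.assoc [symmetric]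
        del: of_real_power)
  then have "(norm (c *s v))\<^sup>2 = (cmod c * norm v)\<^sup>2"
    using of_real_eq_iff by blast
  then show ?thesis
    by (simp add: power2_eq_iff_nonneg)
qed

lemma herm_phase:
  obtains u where "cmod u = 1" "herm (u *s v) w = complex_of_real (cmod (herm v w))"
proof (cases "herm v w = 0")
  case True
  then show ?thesis
    using that [of 1] by (simp add: herm_scale_left)
next
  case False
  define u where "u = cnj (herm v w) / complex_of_real (cmod (herm v w))"
  have "cmod u = 1"
    using False by (simp add: u_def norm_divide)
  moreover have "herm (u *s v) w = complex_of_real (cmod (herm v w))"
    using False complex_norm_square [of "herm v w"]
    by (simp add: herm_scale_left u_def field_simps power2_eq_square)
  ultimately show ?thesis
    using that by blast
qed

lemma herm_Cauchy_Schwarz: "cmod (herm v w) \<le> norm v * norm w"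
proof -
  obtain u where u: "cmod u = 1" "herm (u *s v) w = complex_of_real (cmod (herm v w))"
    by (rule herm_phase)
  then have "cmod (herm v w) = (u *s v) \<bullet> w"
    using Re_herm [of "u *s v" w] by simp
  also have "\<dots> \<le> norm (u *s v) * norm w"
    by (rule norm_cauchy_schwarz)
  finally show ?thesis
    using u by (simp add: norm_cscale)
qed

lemma herm_Cauchy_Schwarz_eq:
  assumes "cmod (herm v w) = norm v * norm w" "v \<noteq> 0" "w \<noteq> 0"
  shows "\<exists>c. c \<noteq> 0 \<and> w = c *s v"
proof -
  obtain u where u: "cmod u = 1" "herm (u *s v) w = complex_of_real (cmod (herm v w))"
    by (rule herm_phase)
  then have "(u *s v) \<bullet> w = norm (u *s v) * norm w"
    using Re_herm [of "u *s v" w] assms(1) by (simp add: norm_cscale)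
  then have "norm (u *s v) *\<^sub>R w = norm w *\<^sub>R (u *s v)"
    by (simp add: norm_cauchy_schwarz_eq)
  then have eq: "norm v *\<^sub>R w = norm w *\<^sub>R (u *s v)"
    using u by (simp add: norm_cscale)
  define c where "c = complex_of_real (norm w / norm v) * u"
  have "w = (1 / norm v) *\<^sub>R (norm v *\<^sub>R w)"
    using assms by simp
  also have "\<dots> = c *s v"
    unfolding eq unfolding vec_eq_iff
    by (simp add: c_def scaleR_conv_of_real [where 'a = complex])
  finally show ?thesis
    using assms by (intro exI [of _ c]) auto
qed

section \<open>Complex projective space with the Fubini--Study distance\<close>

text \<open>
  Projective space of dimension \<open>CARD('n) - 1\<close>: nonzero vectors of homogeneous coordinates, up to
  nonzero scalars.
\<close>

definition proj_rel :: "complex ^ 'n \<Rightarrow> complex ^ 'n \<Rightarrow> bool" where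
  "proj_rel v w \<longleftrightarrow> v \<noteq> 0 \<and> w \<noteq> 0 \<and> (\<exists>c. c \<noteq> 0 \<and> w = c *s v)"

lemma part_equivp_proj_rel: "part_equivp (proj_rel :: complex ^ 'n::finite \<Rightarrow> _)"
proof (rule part_equivpI)
  show "\<exists>v :: complex ^ 'n. proj_rel v v"
    by (rule exI [of _ 1]) (auto simp: proj_rel_def intro!: exI [of _ 1])
  show "symp (proj_rel :: complex ^ 'n \<Rightarrow> _)"
  proof (rule sympI)
    fix v w :: "complex ^ 'n"
    assume "proj_rel v w"
    then obtain c where "v \<noteq> 0" "w \<noteq> 0" "c \<noteq> 0" "w = c *s v"
      by (auto simp: proj_rel_def)
    then show "proj_rel w v"
      unfolding proj_rel_def by (auto simp: vector_smult_assoc intro!: exI [of _ "inverse c"])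
  qed
  show "transp (proj_rel :: complex ^ 'n \<Rightarrow> _)"
  proof (rule transpI)
    fix u v w :: "complex ^ 'n"
    assume "proj_rel u v" "proj_rel v w"
    then obtain c d where "u \<noteq> 0" "w \<noteq> 0" "c \<noteq> 0" "v = c *s u" "d \<noteq> 0" "w = d *s v"
      by (auto simp: proj_rel_def)
    then show "proj_rel u w"
      unfolding proj_rel_def by (auto simp: vector_smult_assoc intro!: exI [of _ "d * c"])
  qed
qed

quotient_type 'n cproj = "complex ^ 'n::finite" / partial: proj_rel
  by (rule part_equivp_proj_rel)

text \<open>\<open>proj_pt v\<close> is the point \<open>[v]\<close>, meaningful for \<open>v \<noteq> 0\<close> only.\<close>

definition proj_pt :: "complex ^ 'n::finite \<Rightarrow> 'n cproj" where
  "proj_pt v = abs_cproj v"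

lemma proj_pt_eq_iff:
  assumes "v \<noteq> 0" "w \<noteq> 0"
  shows "proj_pt v = proj_pt w \<longleftrightarrow> (\<exists>c. c \<noteq> 0 \<and> w = c *s v)"
proof -
  have "proj_rel v v" "proj_rel w w"
    using assms by (auto simp: proj_rel_def intro!: exI [of _ 1])
  then have "proj_pt v = proj_pt w \<longleftrightarrow> proj_rel v w"
    unfolding proj_pt_def using Quotient3_rel [OF Quotient3_cproj, of v w] by simp
  then show ?thesis
    using assms by (simp add: proj_rel_def)
qed

lemma cproj_cases:
  obtains v where "v \<noteq> 0" "x = proj_pt v"
proof -
  have "proj_rel (rep_cproj x) (rep_cproj x)"
    using Quotient3_rep_reflp [OF Quotient3_cproj] by blast
  moreover have "x = proj_pt (rep_cproj x)"
    unfolding proj_pt_def using Quotient3_abs_rep [OF Quotient3_cproj] by metis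
  ultimately show ?thesis
    using that proj_rel_def by blast
qed

definition angle :: "complex ^ 'n \<Rightarrow> complex ^ 'n \<Rightarrow> real" where
  "angle v w = arccos (cmod (herm v w) / (norm v * norm w))"

lemma angle_scale:
  assumes "c \<noteq> 0" "d \<noteq> 0"
  shows "angle (c *s v) (d *s w) = angle v w"
  using assms by (simp add: angle_def herm_scale_left herm_scale_right norm_cscale norm_mult)

lemma angle_ratio: "cmod (herm v w) / (norm v * norm w) \<in> {0..1}"
  proof -
  have "cmod (herm v w) / (norm v * norm w) \<le> 1"
    using herm_Cauchy_Schwarz [of v w] by (cases "norm v * norm w = 0") (auto simp: divide_le_eq mult_less_0_iff)
  then show ?thesis by simp
qed

lemma angle_eq_0_iff:
  assumes "v \<noteq> 0" "w \<noteq> 0"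
  shows "angle v w = 0 \<longleftrightarrow> (\<exists>c. c \<noteq> 0 \<and> w = c *s v)"
proof
  assume "angle v w = 0"
  then have "cmod (herm v w) / (norm v * norm w) = 1"
    using angle_ratio [of v w] cos_arccos [of "cmod (herm v w) / (norm v * norm w)"]
    unfolding angle_def atLeastAtMost_iff by (metis cos_zero dual_order.trans le_minus_one_simps(1))
  then show "\<exists>c. c \<noteq> 0 \<and> w = c *s v"
    using assms by (intro herm_Cauchy_Schwarz_eq) (auto simp: field_simps)
next
  assume "\<exists>c. c \<noteq> 0 \<and> w = c *s v"
  then obtain c where c: "c \<noteq> 0" "w = c *s v"
    by blast
  then have "angle v w = angle v v"
    using angle_scale [of 1 c v v] by simp
  also have "\<dots> = 0"
    using assms by (simp add: angle_def herm_self power2_eq_square norm_mult)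
  finally show "angle v w = 0" .
qed

lemma arccos_inner_triangle:
  fixes x y z :: "'a::real_inner"
  assumes "norm x = 1" "norm y = 1" "norm z = 1"
  shows "arccos (x \<bullet> z) \<le> arccos (x \<bullet> y) + arccos (y \<bullet> z)"
proof -
  have bound: "\<bar>p \<bullet> q\<bar> \<le> 1" if "norm p = 1" "norm q = 1" for p q :: 'a
    using Cauchy_Schwarz_ineq2 [of p q] that by simp
  define a where "a = arccos (x \<bullet> y)"
  define b where "b = arccos (y \<bullet> z)"
  have ab: "0 \<le> a" "0 \<le> b" "cos a = x \<bullet> y" "cos b = y \<bullet> z"
    "sin a = sqrt (1 - (x \<bullet> y)\<^sup>2)" "sin b = sqrt (1 - (y \<bullet> z)\<^sup>2)"
    using bound [of x y] bound [of y z] assms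
    by (auto simp: a_def b_def sin_arccos_abs arccos_lbound abs_le_iff cos_arccos_abs)
  have one: "x \<bullet> x = 1" "y \<bullet> y = 1" "z \<bullet> z = 1"
    using assms by (auto simp: norm_eq_1)
  let ?p = "x - (x \<bullet> y) *\<^sub>R y" and ?q = "z - (y \<bullet> z) *\<^sub>R y"
  have "norm ?p = sin a"
    unfolding ab norm_eq_sqrt_inner
    by (simp add: inner_diff_left inner_diff_right one inner_commute power2_eq_square)
  moreover have "norm ?q = sin b"
    unfolding ab norm_eq_sqrt_inner
    by (simp add: inner_diff_left inner_diff_right one inner_commute power2_eq_square)
  moreover have "?p \<bullet> ?q = x \<bullet> z - cos a * cos b"
    unfolding ab by (simp add: inner_diff_left inner_diff_right one inner_commute)
  moreover have "- (norm ?p * norm ?q) \<le> ?p \<bullet> ?q"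
    using Cauchy_Schwarz_ineq2 [of ?p ?q] by linarith
  ultimately have le: "cos (a + b) \<le> x \<bullet> z"
    by (simp add: cos_add)
  show ?thesis
  proof (cases "a + b \<le> pi")
    case True
    then have "a + b = arccos (cos (a + b))"
      using ab by (simp add: arccos_cos)
    also have "\<dots> \<ge> arccos (x \<bullet> z)"
      using le bound [of x z] assms by (intro arccos_le_arccos) (auto simp: abs_le_iff)
    finally show ?thesis
      by (simp add: a_def b_def)
  next
    case False
    then show ?thesis
      using arccos_ubound [of "x \<bullet> z"] bound [of x z] assms by (auto simp: a_def b_def abs_le_iff)
  qed
qed

lemma angle_triangle:
  assumes "x \<noteq> 0" "y \<noteq> 0" "z \<noteq> 0"
  shows "angle x z \<le> angle x y + angle y z"
proof -
  obtain u where u: "cmod u = 1" "herm (u *s x) y = complex_of_real (cmod (herm x y))"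
    by (rule herm_phase)
  obtain t where t: "cmod t = 1" "herm (t *s z) y = complex_of_real (cmod (herm z y))"
    by (rule herm_phase)
  define X where "X = complex_of_real (1 / norm x) *s (u *s x)"
  define Y where "Y = complex_of_real (1 / norm y) *s y"
  define Z where "Z = complex_of_real (1 / norm z) *s (t *s z)"
  have unit: "norm X = 1" "norm Y = 1" "norm Z = 1"
    using assms u t by (auto simp: X_def Y_def Z_def norm_cscale norm_divide)
  have nz: "u \<noteq> 0" "t \<noteq> 0"
    using u t by auto
  have ang: "angle X Y = angle x y" "angle Y Z = angle y z" "angle X Z = angle x z"
    unfolding X_def Y_def Z_def vector_smult_assoc
    by (rule angle_scale; use assms nz in simp)+
  have XY: "X \<bullet> Y = cmod (herm X Y)"
    unfolding Re_herm [symmetric] X_def Y_def herm_scale_left [of "complex_of_real _"]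
      herm_scale_right u by (simp add: norm_mult norm_divide)
  have ZY: "Z \<bullet> Y = cmod (herm Z Y)"
    unfolding Re_herm [symmetric] Z_def Y_def herm_scale_left [of "complex_of_real _"]
      herm_scale_right t by (simp add: norm_mult norm_divide)
  have YZ: "Y \<bullet> Z = cmod (herm Y Z)"
    using ZY cnj_herm [of Z Y] by (metis inner_commute complex_mod_cnj)
  have "angle X Z \<le> arccos (X \<bullet> Z)"
    unfolding angle_def using unit
    using complex_Re_le_cmod [of "herm X Z"] herm_Cauchy_Schwarz [of X Z]
      Cauchy_Schwarz_ineq2 [of X Z]
    by (intro arccos_le_arccos) (auto simp: Re_herm abs_le_iff)
  also have "\<dots> \<le> arccos (X \<bullet> Y) + arccos (Y \<bullet> Z)"
    using unit by (intro arccos_inner_triangle)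
  also have "\<dots> = angle X Y + angle Y Z"
    using unit by (simp add: XY YZ angle_def)
  finally show ?thesis
    by (simp add: ang)
qed

instantiation cproj :: (finite) metric_space
begin

text \<open>
  The geodesic distance of the Fubini--Study metric, normalised as in \<open>fs_norm\<close> below; its open
  sets are those of the usual topology of projective space.
\<close>

lift_definition dist_cproj :: "'a cproj \<Rightarrow> 'a cproj \<Rightarrow> real" is angle
  by (auto simp: proj_rel_def angle_scale)

definition uniformity_cproj :: "('a cproj \<times> 'a cproj) filter" where
  "uniformity_cproj = (INF e\<in>{0 <..}. principal {(x, y). dist x y < e})"

definition open_cproj :: "'a cproj set \<Rightarrow> bool" where
  "open_cproj S = (\<forall>x\<in>S. \<forall>\<^sub>F (x', y) in uniformity. x' = x \<longrightarrow> y \<in> S)"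

lemma dist_proj_pt:
  assumes "v \<noteq> 0" "w \<noteq> 0"
  shows "dist (proj_pt v :: 'a cproj) (proj_pt w) = angle v w"
proof -
  have "proj_rel v v" "proj_rel w w"
    using assms by (auto simp: proj_rel_def intro!: exI [of _ 1])
  then show ?thesis
    unfolding proj_pt_def by (rule dist_cproj.abs_eq)
qed

instance
proof
  fix x y z :: "'a cproj"
  obtain u where u: "u \<noteq> 0" "x = proj_pt u" by (rule cproj_cases)
  obtain v where v: "v \<noteq> 0" "y = proj_pt v" by (rule cproj_cases)
  obtain w where w: "w \<noteq> 0" "z = proj_pt w" by (rule cproj_cases)
  show "dist x y = 0 \<longleftrightarrow> x = y"
    using u v by (simp add: dist_proj_pt angle_eq_0_iff proj_pt_eq_iff)
  have "angle v w = angle w v"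
    unfolding angle_def by (metis cnj_herm complex_mod_cnj mult.commute)
  then show "dist x y \<le> dist x z + dist y z"
    using u v w angle_triangle [of u w v] by (simp add: dist_proj_pt)
qed (simp_all add: uniformity_cproj_def open_cproj_def)

end

section \<open>Holomorphic maps into projective space\<close>

definition holomorphic_lift ::
    "(complex \<Rightarrow> 'n::finite cproj) \<Rightarrow> complex set \<Rightarrow> (complex \<Rightarrow> complex ^ 'n) \<Rightarrow> bool" where
  "holomorphic_lift f U F \<longleftrightarrow>
     (\<forall>i. (\<lambda>z. F z $ i) holomorphic_on U) \<and> (\<forall>z\<in>U. F z \<noteq> 0 \<and> f z = proj_pt (F z))"

text \<open>\<open>A\<close> is meant to be open.\<close>

definition proj_holomorphic_on ::
    "(complex \<Rightarrow> 'n::finite cproj) \<Rightarrow> complex set \<Rightarrow> bool" where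
  "proj_holomorphic_on f A \<longleftrightarrow>
     (\<forall>z\<in>A. \<exists>U F. open U \<and> z \<in> U \<and> U \<subseteq> A \<and> holomorphic_lift f U F)"

text \<open>
  Maps with domain \<open>A\<close> are represented by functions that are \<open>undefined\<close> outside \<open>A\<close>, so that
  equality of functions is equality of maps on \<open>A\<close>.
\<close>

definition Hol :: "complex set \<Rightarrow> 'n::finite cproj set \<Rightarrow> (complex \<Rightarrow> 'n cproj) set" where
  "Hol A X = {f \<in> A \<rightarrow>\<^sub>E X. proj_holomorphic_on f A}"

definition compact_open ::
    "complex set \<Rightarrow> 'n::finite cproj set \<Rightarrow> (complex \<Rightarrow> 'n cproj) topology" where
  "compact_open A X = topology_generated_by
     {{f \<in> Hol A X. f ` K \<subseteq> U} | K U. compact K \<and> K \<subseteq> A \<and> open U}"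

definition normal_family ::
    "complex set \<Rightarrow> 'n::finite cproj set \<Rightarrow> (complex \<Rightarrow> 'n cproj) set \<Rightarrow> bool" where
  "normal_family A X \<F> \<longleftrightarrow> compactin (compact_open A X) (compact_open A X closure_of \<F>)"

definition compactly_divergent ::
    "complex set \<Rightarrow> 'n::finite cproj set \<Rightarrow> (nat \<Rightarrow> complex \<Rightarrow> 'n cproj) \<Rightarrow> bool" where
  "compactly_divergent A X f \<longleftrightarrow>
     (\<forall>K L. compact K \<and> K \<subseteq> A \<and> compact L \<and> L \<subseteq> X \<longrightarrow> (\<exists>j0. \<forall>j\<ge>j0. f j ` K \<inter> L = {}))"

section \<open>Fubini--Study length, Brody curves and limit type\<close>

text \<open>
  Fubini--Study length of the tangent vector at \<open>[v]\<close> that is the image of \<open>w\<close>, i.e. the norm of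
  the component of \<open>w\<close> orthogonal to \<open>v\<close>, divided by the norm of \<open>v\<close>.
\<close>

definition fs_norm :: "complex ^ 'n \<Rightarrow> complex ^ 'n \<Rightarrow> real" where
  "fs_norm v w = sqrt ((norm v)\<^sup>2 * (norm w)\<^sup>2 - (cmod (herm w v))\<^sup>2) / (norm v)\<^sup>2"

definition vderiv :: "(complex \<Rightarrow> complex ^ 'n) \<Rightarrow> complex \<Rightarrow> complex ^ 'n" where
  "vderiv F z = (\<chi> i. deriv (\<lambda>\<zeta>. F \<zeta> $ i) z)"

text \<open>
  Fubini--Study length of \<open>f'(z)\<close>, computed from any local holomorphic lift of \<open>f\<close>; the lemma
  \<open>fs_speed_eq\<close> below shows that the lift does not matter.
\<close>

definition fs_speed :: "(complex \<Rightarrow> 'n::finite cproj) \<Rightarrow> complex \<Rightarrow> real" where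
  "fs_speed f z = (THE r. \<exists>U F. open U \<and> z \<in> U \<and> holomorphic_lift f U F \<and>
     r = fs_norm (F z) (vderiv F z))"

lemma fs_norm_change:
  assumes "c \<noteq> 0" "v \<noteq> 0"
  shows "fs_norm (c *s v) (c *s w + d *s v) = fs_norm v w"
proof -
  let ?G = "\<lambda>v w. (norm v)\<^sup>2 * (norm w)\<^sup>2 - (cmod (herm w v))\<^sup>2"
  have G: "complex_of_real (?G v w) = herm v v * herm w w - herm w v * herm v w"
    for v w :: "complex ^ 'a"
    by (simp add: herm_self complex_norm_square cnj_herm del: of_real_power)
  have "complex_of_real (?G (c *s v) (c *s w + d *s v)) = complex_of_real ((cmod c) ^ 4 * ?G v w)"
  proof -
    have c4: "complex_of_real ((cmod c) ^ 4) = (c * cnj c) * (c * cnj c)"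
      using complex_norm_square [of c] by (simp add: power4_eq_xxxx power2_eq_square)
    show ?thesis
      unfolding of_real_mult c4 G
      by (simp add: herm_add_left herm_add_right herm_scale_left herm_scale_right algebra_simps)
  qed
  then have "?G (c *s v) (c *s w + d *s v) = (cmod c) ^ 4 * ?G v w"
    using of_real_eq_iff by blast
  moreover have "sqrt ((cmod c) ^ 4) = (cmod c)\<^sup>2"
    by (rule real_sqrt_unique) (simp_all flip: power_mult)
  ultimately show ?thesis
    unfolding fs_norm_def using assms
    by (simp add: real_sqrt_mult norm_cscale power_mult_distrib)
qed

lemma fs_norm_lift_unique:
  assumes "open U" "z \<in> U" "holomorphic_lift f U F"
    and "open V" "z \<in> V" "holomorphic_lift f V G"
  shows "fs_norm (G z) (vderiv G z) = fs_norm (F z) (vderiv F z)"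
proof -
  have scaled: "\<exists>c. c \<noteq> 0 \<and> G \<zeta> = c *s F \<zeta>" if "\<zeta> \<in> U \<inter> V" for \<zeta>
    using that assms proj_pt_eq_iff [of "F \<zeta>" "G \<zeta>"] by (auto simp: holomorphic_lift_def)
  have Fz: "F z \<noteq> 0"
    using assms by (auto simp: holomorphic_lift_def)
  then obtain i where i: "F z $ i \<noteq> 0"
    by (auto simp: vec_eq_iff)
  obtain c where c: "c \<noteq> 0" "G z = c *s F z"
    using scaled [of z] assms by blast
  have dF: "((\<lambda>\<zeta>. F \<zeta> $ k) has_field_derivative vderiv F z $ k) (at z)" for k
    unfolding vderiv_def using assms holomorphic_derivI [of "\<lambda>\<zeta>. F \<zeta> $ k" U z]
    by (simp add: holomorphic_lift_def)
  have dG: "((\<lambda>\<zeta>. G \<zeta> $ k) has_field_derivative vderiv G z $ k) (at z)" for k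
    unfolding vderiv_def using assms holomorphic_derivI [of "\<lambda>\<zeta>. G \<zeta> $ k" V z]
    by (simp add: holomorphic_lift_def)
  define d where "d = (vderiv G z $ i - c * vderiv F z $ i) / F z $ i"
  have "vderiv G z $ k = c * vderiv F z $ k + d * F z $ k" for k
  proof -
    have "((\<lambda>\<zeta>. G \<zeta> $ k * F \<zeta> $ i - G \<zeta> $ i * F \<zeta> $ k) has_field_derivative
        (vderiv G z $ k * F z $ i + vderiv F z $ i * G z $ k
          - (vderiv G z $ i * F z $ k + vderiv F z $ k * G z $ i))) (at z)"
      by (intro DERIV_diff DERIV_mult dF dG)
    moreover have "((\<lambda>\<zeta>. G \<zeta> $ k * F \<zeta> $ i - G \<zeta> $ i * F \<zeta> $ k) has_field_derivative 0) (at z)"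
    proof (rule DERIV_cong_ev [THEN iffD2])
      show "((\<lambda>_. 0) has_field_derivative 0) (at z)"
        by simp
      have "\<forall>\<^sub>F \<zeta> in nhds z. \<zeta> \<in> U \<inter> V"
        using assms by (intro eventually_nhds_in_open) auto
      then show "\<forall>\<^sub>F \<zeta> in nhds z. G \<zeta> $ k * F \<zeta> $ i - G \<zeta> $ i * F \<zeta> $ k = 0"
        by eventually_elim (use scaled in force)
    qed auto
    ultimately have "vderiv G z $ k * F z $ i + vderiv F z $ i * G z $ k
          - (vderiv G z $ i * F z $ k + vderiv F z $ k * G z $ i) = 0"
      by (rule DERIV_unique)
    then show ?thesis
      using i by (simp add: c d_def field_simps)
  qed
  then have "vderiv G z = c *s vderiv F z + d *s F z"
    by (simp add: vec_eq_iff)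
  then show ?thesis
    using c Fz by (simp add: fs_norm_change)
qed

lemma fs_speed_eq:
  assumes "open U" "z \<in> U" "holomorphic_lift f U F"
  shows "fs_speed f z = fs_norm (F z) (vderiv F z)"
  unfolding fs_speed_def
  by (rule the_equality) (use assms fs_norm_lift_unique [OF assms] in blast)+

definition FS_Brody_curve :: "'n::finite cproj set \<Rightarrow> (complex \<Rightarrow> 'n cproj) \<Rightarrow> bool" where
  "FS_Brody_curve X g \<longleftrightarrow> g \<in> Hol UNIV X \<and> bounded (range (fs_speed g))"

text \<open>
  \<open>X\<close> is meant to be a domain. The values of \<open>f j\<close> outside the disc play no role in the uniform
  limit: every compact \<open>K\<close> satisfies \<open>p j + \<rho> j * \<xi> \<in> ball 0 1\<close> for all \<open>\<xi> \<in> K\<close> and all large \<open>j\<close>.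
\<close>

definition FS_limit_type :: "'n::finite cproj set \<Rightarrow> bool" where
  "FS_limit_type X \<longleftrightarrow>
     (\<forall>\<F> \<subseteq> Hol (ball 0 1) X.
        \<not> normal_family (ball 0 1) X \<F> \<and>
        \<not> (\<exists>f. range f \<subseteq> \<F> \<and> compactly_divergent (ball 0 1) X f) \<longrightarrow>
        (\<exists>(p :: nat \<Rightarrow> complex) p0 f (\<rho> :: nat \<Rightarrow> real) g.
           range p \<subseteq> ball 0 1 \<and> p0 \<in> ball 0 1 \<and> p \<longlonglongrightarrow> p0 \<and>
           range f \<subseteq> \<F> \<and>
           (\<forall>j. \<rho> j > 0) \<and> \<rho> \<longlonglongrightarrow> 0 \<and>
           (\<forall>K. compact K \<longrightarrow>
              uniform_limit K (\<lambda>j \<xi>. f j (p j + complex_of_real (\<rho> j) * \<xi>)) g sequentially) \<and>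
           FS_Brody_curve X g \<and> \<not> g constant_on UNIV))"

definition torus2 :: "3 cproj set" where
  "torus2 = {proj_pt (vector [1, z1, z2]) | z1 z2. z1 \<noteq> 0 \<and> z2 \<noteq> 0}"

end

theory Submission
  imports Defs
begin

no_notation fps_nth (infixl "$" 75)

text \<open>
  Let \<open>h z = [1 : exp z : exp (z\<^sup>2)]\<close> and consider the family of the maps \<open>z \<mapsto> h (n z)\<close> on the disc.
  All of them agree at \<open>0\<close>, so no sequence of them is compactly divergent; the map \<open>h\<close> is proper
  into the torus, so their values at \<open>1/2\<close> leave every compact set and the family is not normal.
  A rescaled sequence has the form \<open>\<xi> \<mapsto> h (a\<^sub>j + b\<^sub>j \<xi>)\<close>; if it converges, then properness
  bounds \<open>a\<^sub>j\<close> and \<open>b\<^sub>j\<close>, so that the limit is \<open>\<xi> \<mapsto> h (a + b \<xi>)\<close>. If \<open>b \<noteq> 0\<close>, this is not a Brody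
  curve: at the points \<open>z = t (-1 + \<i>)\<close> one has \<open>\<bar>exp (z\<^sup>2)\<bar> = 1\<close> and \<open>exp z \<longrightarrow> 0\<close>, so the speed of
  \<open>h\<close> grows like \<open>\<bar>z\<bar>\<close>.
\<close>

section \<open>Convergence and the Fubini-Study norm in homogeneous coordinates\<close>

lemma tendsto_proj_pt:
  fixes v :: "'a \<Rightarrow> complex ^ 'n::finite"
  assumes "(v \<longlongrightarrow> l) F" "l \<noteq> 0"
  shows "((\<lambda>x. proj_pt (v x)) \<longlongrightarrow> proj_pt l) F"
proof (rule tendstoI)
  fix e :: real
  assume "e > 0"
  have "((\<lambda>x. cmod (herm (v x) l) / (norm (v x) * norm l)) \<longlongrightarrow>
      cmod (herm l l) / (norm l * norm l)) F"
    unfolding herm_def using assms by (intro tendsto_intros) auto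
  then have "((\<lambda>x. cmod (herm (v x) l) / (norm (v x) * norm l)) \<longlongrightarrow> 1) F"
    using assms by (simp add: herm_self power2_eq_square norm_mult)
  then have "((\<lambda>x. angle (v x) l) \<longlongrightarrow> arccos 1) F"
    unfolding angle_def
  \<comment> \<open>The limit 1 is an endpoint of the domain of \<open>arccos\<close>, so continuity
    is available only on [-1,1] and the ratios must be shown to stay there.\<close>
  proof (rule continuous_on_tendsto_compose [OF continuous_on_arccos'])
    show "\<forall>\<^sub>F x in F. cmod (herm (v x) l) / (norm (v x) * norm l) \<in> {-1..1}"
      using angle_ratio [of _ l] by (auto intro!: always_eventually intro: order_trans [of _ 0])
  qed auto
  then have "\<forall>\<^sub>F x in F. angle (v x) l < e"
    using \<open>e > 0\<close> by (simp add: order_tendstoD(2))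
  moreover have "\<forall>\<^sub>F x in F. v x \<noteq> 0"
    using assms tendsto_imp_eventually_ne by blast
  ultimately show "\<forall>\<^sub>F x in F. dist (proj_pt (v x)) (proj_pt l) < e"
    by eventually_elim (use assms in \<open>simp add: dist_proj_pt\<close>)
qed

lemma cos_dist_axis:
  assumes "v \<noteq> 0"
  shows "cos (dist (proj_pt v) (proj_pt (axis i 1))) = cmod (v $ i) / norm v"
proof -
  have "herm v (axis i 1) = (\<Sum>k\<in>UNIV. if k = i then v $ i else 0)"
    unfolding herm_def axis_def by (rule sum.cong) auto
  then have "herm v (axis i 1) = v $ i"
    by simp
  moreover have "norm (axis i 1 :: complex ^ 'a) = 1" "(axis i 1 :: complex ^ 'a) \<noteq> 0"
    by (simp_all add: axis_eq_0_iff)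
  moreover have "cmod (v $ i) / norm v \<in> {0..1}"
    using angle_ratio [of v "axis i 1"] calculation by simp
  ultimately show ?thesis
    using assms by (simp add: dist_proj_pt angle_def cos_arccos_abs)
qed

text \<open>Lagrange's identity for the Gram determinant under the root in \<open>fs_norm\<close>.
  Once squared moduli are written as products with conjugates, both sides are the same
  polynomial.\<close>

lemma lagrange_identity_3:
  fixes v w :: "complex ^ 3"
  shows "(norm v)\<^sup>2 * (norm w)\<^sup>2 - (cmod (herm w v))\<^sup>2 =
    (cmod (v $ 1 * w $ 2 - v $ 2 * w $ 1))\<^sup>2 + (cmod (v $ 1 * w $ 3 - v $ 3 * w $ 1))\<^sup>2 +
    (cmod (v $ 2 * w $ 3 - v $ 3 * w $ 2))\<^sup>2" (is "?l = ?r")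
proof -
  have "complex_of_real ?l = herm v v * herm w w - herm w v * herm v w"
    by (simp add: herm_self complex_norm_square cnj_herm del: of_real_power)
  also have "\<dots> = complex_of_real ?r"
    by (simp add: herm_def sum_3 complex_norm_square algebra_simps del: of_real_power)
  finally show ?thesis
    using of_real_eq_iff by blast
qed

text \<open>Two of the three squared minors are dropped. The one kept suits \<open>exp_lift\<close>:
  its first coordinate is constantly 1, so this minor is just the derivative of the third
  coordinate.\<close>

lemma fs_norm_ge:
  fixes v w :: "complex ^ 3"
  shows "cmod (v $ 1 * w $ 3 - v $ 3 * w $ 1) / (norm v)\<^sup>2 \<le> fs_norm v w"
  unfolding fs_norm_def lagrange_identity_3
  by (intro divide_right_mono real_le_rsqrt) auto

section \<open>The exponential curve and its properness into the torus\<close>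

definition exp_lift :: "complex \<Rightarrow> complex ^ 3" where
  "exp_lift z = vector [1, exp z, exp (z\<^sup>2)]"

definition exp_curve :: "complex \<Rightarrow> 3 cproj" where
  "exp_curve z = proj_pt (exp_lift z)"

lemma exp_lift_nth [simp]:
  "exp_lift z $ 1 = 1" "exp_lift z $ 2 = exp z" "exp_lift z $ 3 = exp (z\<^sup>2)"
  by (simp_all add: exp_lift_def)

lemma exp_lift_nonzero [simp]: "exp_lift z \<noteq> 0"
  using exp_lift_nth(1) [of z] by (metis zero_index zero_neq_one)

lemma norm_exp_lift:
  "(norm (exp_lift z))\<^sup>2 = 1 + exp (2 * Re z) + exp (2 * Re (z\<^sup>2))"
  by (simp add: norm_vec_def L2_set_def sum_3 exp_double)

lemma exp_curve_in_torus2: "exp_curve z \<in> torus2"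
  unfolding exp_curve_def exp_lift_def torus2_def using exp_not_eq_zero by blast

lemma tendsto_exp_curve:
  assumes "(u \<longlongrightarrow> l) F"
  shows "((\<lambda>x. exp_curve (u x)) \<longlongrightarrow> exp_curve l) F"
  unfolding exp_curve_def
proof (intro tendsto_proj_pt vec_tendstoI)
  fix i :: 3
  have "((\<lambda>x. exp_lift (u x) $ i) \<longlongrightarrow> exp_lift l $ i) F" for i
    using assms exhaust_3 [of i] by (auto intro!: tendsto_const tendsto_exp tendsto_power)
  then show "((\<lambda>x. exp_lift (u x) $ i) \<longlongrightarrow> exp_lift l $ i) F" .
qed simp

lemma holomorphic_lift_exp_curve:
  assumes "\<And>z. z \<in> A \<Longrightarrow> f z = exp_curve (a + b * z)"
  shows "holomorphic_lift f A (\<lambda>z. exp_lift (a + b * z))"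
proof -
  have "(\<lambda>z. exp_lift (a + b * z) $ i) holomorphic_on A" for i
    using exhaust_3 [of i] by (auto intro!: holomorphic_intros)
  then show ?thesis
    using assms by (simp add: holomorphic_lift_def exp_curve_def)
qed

text \<open>
  On the projective plane \<open>\<bar>v\<^sub>i\<bar> / \<bar>v\<bar>\<close> is the cosine of the distance to a coordinate point, hence
  continuous, and on compact subsets of the torus it is bounded below for each \<open>i\<close>.
\<close>

lemma compact_torus2_cos_dist_axis:
  assumes "compact L" "L \<subseteq> torus2"
  obtains \<delta> where "\<delta> > 0" "\<And>x. x \<in> L \<Longrightarrow> \<delta> \<le> cos (dist x (proj_pt (axis i 1)))"
proof (cases "L = {}")
  case True
  then show ?thesis
    using that [of 1] by simp
next
  case False
  have "continuous_on L (\<lambda>x. cos (dist x (proj_pt (axis i 1))))"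
    by (intro continuous_intros)
  then obtain x where x: "x \<in> L"
    "\<And>y. y \<in> L \<Longrightarrow> cos (dist x (proj_pt (axis i 1))) \<le> cos (dist y (proj_pt (axis i 1)))"
    using continuous_attains_inf [OF assms(1) False] by blast
  then obtain z1 z2 where z: "z1 \<noteq> 0" "z2 \<noteq> 0" "x = proj_pt (vector [1, z1, z2])"
    using assms by (auto simp: torus2_def)
  define v :: "complex ^ 3" where "v = vector [1, z1, z2]"
  have v: "v $ k \<noteq> 0" for k
    using exhaust_3 [of k] z by (auto simp: v_def)
  then have "v \<noteq> 0"
    by (metis zero_index)
  then have "cos (dist x (proj_pt (axis i 1))) > 0"
    using cos_dist_axis [of v i] v [of i] z by (simp add: v_def)
  then show ?thesis
    using that x by blast
qed

text \<open>Over L every coordinate of the lift is comparable with its norm. As the first coordinate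
  is 1, the norm lies between 1 and 1 / \<open>\<delta> 1\<close>, which keeps exp z and exp (z^2)
  away from 0 and infinity. Logarithms then bound Re z and Re (z^2) = (Re z)^2 - (Im z)^2, and hence
  Im z.\<close>

lemma exp_curve_proper:
  assumes "compact L" "L \<subseteq> torus2"
  obtains R where "\<And>z. exp_curve z \<in> L \<Longrightarrow> cmod z \<le> R"
proof -
  have "\<exists>\<delta>. \<delta> > 0 \<and> (\<forall>z. exp_curve z \<in> L \<longrightarrow> \<delta> * norm (exp_lift z) \<le> cmod (exp_lift z $ i))" for i
  proof -
    obtain \<delta> where \<delta>: "\<delta> > 0" "\<And>x. x \<in> L \<Longrightarrow> \<delta> \<le> cos (dist x (proj_pt (axis i 1)))"
      using compact_torus2_cos_dist_axis [OF assms] by blast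
    have "\<delta> * norm (exp_lift z) \<le> cmod (exp_lift z $ i)" if "exp_curve z \<in> L" for z
      using \<delta>(2) [OF that] cos_dist_axis [of "exp_lift z" i]
      by (simp add: exp_curve_def field_simps)
    then show ?thesis
      using \<delta>(1) by blast
  qed
  then obtain \<delta> where \<delta>: "\<And>i. \<delta> i > 0"
    "\<And>z i. exp_curve z \<in> L \<Longrightarrow> \<delta> i * norm (exp_lift z) \<le> cmod (exp_lift z $ i)"
    by metis
  \<comment> \<open>One constant dominating all the logarithmic bounds:
    \<open>ln (\<delta> i)\<close> from below and \<open>- ln (\<delta> 1)\<close> from
    above.\<close>
  define M where "M = \<bar>ln (\<delta> 1)\<bar> + \<bar>ln (\<delta> 2)\<bar> + \<bar>ln (\<delta> 3)\<bar>"
  have "cmod z \<le> M + sqrt (M + M\<^sup>2)" if z: "exp_curve z \<in> L" for z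
  proof -
    have N: "cmod (exp_lift z $ i) \<le> norm (exp_lift z)" for i
      by (rule Finite_Cartesian_Product.norm_nth_le)
    have lower: "ln (\<delta> i) \<le> ln (cmod (exp_lift z $ i))" if "exp_lift z $ i \<noteq> 0" for i
    proof -
      have "\<delta> i * 1 \<le> \<delta> i * norm (exp_lift z)"
        using N [of 1] \<delta>(1) [of i] by (intro mult_left_mono) auto
      also have "\<dots> \<le> cmod (exp_lift z $ i)"
        using z by (rule \<delta>(2))
      finally show ?thesis
        using \<delta>(1) [of i] that by simp
    qed
    have upper: "ln (cmod (exp_lift z $ i)) \<le> - ln (\<delta> 1)" if "exp_lift z $ i \<noteq> 0" for i
    proof -
      have "\<delta> 1 * cmod (exp_lift z $ i) \<le> \<delta> 1 * norm (exp_lift z)"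
        using N \<delta>(1) [of 1] by (intro mult_left_mono) auto
      also have "\<dots> \<le> 1"
        using \<delta>(2) [OF z, of 1] by simp
      finally have "ln (\<delta> 1 * cmod (exp_lift z $ i)) \<le> 0"
        using \<delta>(1) [of 1] that by simp
      then show ?thesis
        using \<delta>(1) [of 1] that by (simp add: ln_mult)
    qed
    have "\<bar>Re z\<bar> \<le> M" "\<bar>Re (z\<^sup>2)\<bar> \<le> M"
      using lower [of 2] lower [of 3] upper [of 2] upper [of 3] by (auto simp: M_def)
    then have re: "\<bar>Re z\<bar> \<le> M" and "(Im z)\<^sup>2 \<le> M + (Re z)\<^sup>2"
      by (auto simp: power2_eq_square abs_le_iff)
    then have "(Im z)\<^sup>2 \<le> M + M\<^sup>2"
      using abs_le_square_iff [of "Re z" M] by simp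
    then have "\<bar>Im z\<bar> \<le> sqrt (M + M\<^sup>2)"
      using real_le_rsqrt by fastforce
    then show ?thesis
      using re cmod_le [of z] by linarith
  qed
  then show ?thesis
    using that by blast
qed

section \<open>Limits of affine reparametrizations of the curve\<close>

lemma Bseq_if_exp_curve_tendsto:
  assumes "(\<lambda>j. exp_curve (u j)) \<longlonglongrightarrow> x" "x \<in> torus2"
  shows "Bseq u"
proof -
  \<comment> \<open>A convergent sequence together with its limit is compact; as x lies in the
    torus, so does this whole set, and properness applies.\<close>
  have "compact (insert x (range (\<lambda>j. exp_curve (u j))))"
    using compactin_sequence_with_limit [of euclidean _ x] assms(1) by simp
  then obtain R where "\<And>z. exp_curve z \<in> insert x (range (\<lambda>j. exp_curve (u j))) \<Longrightarrow> cmod z \<le> R"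
    using assms(2) exp_curve_in_torus2 by (elim exp_curve_proper) auto
  then show ?thesis
    by (intro BseqI') auto
qed

text \<open>Properness at \<xi> = 0 and \<xi> = 1 bounds \<open>a j\<close> and
  \<open>a j + b j\<close>. The coefficients themselves need not converge, but along a common
  subsequence they do, and g is also the limit along that subsequence.\<close>

lemma limit_of_rescaled_exp_curve:
  fixes a b :: "nat \<Rightarrow> complex"
  assumes lim: "\<And>\<xi>. (\<lambda>j. exp_curve (a j + b j * \<xi>)) \<longlonglongrightarrow> g \<xi>"
    and "range g \<subseteq> torus2"
  obtains a0 b0 where "g = (\<lambda>\<xi>. exp_curve (a0 + b0 * \<xi>))"
proof -
  have "Bseq (\<lambda>j. a j + b j * \<xi>)" for \<xi>
    using assms(2) by (intro Bseq_if_exp_curve_tendsto [OF lim]) auto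
  from this [of 0] this [of 1] have "bounded (range a)" "bounded (range (\<lambda>j. a j + b j))"
    by (simp_all add: Bseq_eq_bounded [symmetric])
  then have "bounded (range a \<times> range (\<lambda>j. a j + b j))"
    by (rule bounded_Times)
  then have "bounded (range (\<lambda>j. (a j, a j + b j)))"
    by (rule bounded_subset) auto
  then obtain r l where r: "strict_mono r" "((\<lambda>j. (a j, a j + b j)) \<circ> r) \<longlonglongrightarrow> l"
    using bounded_imp_convergent_subsequence by blast
  have ab: "(\<lambda>j. a (r j)) \<longlonglongrightarrow> fst l" "(\<lambda>j. a (r j) + b (r j)) \<longlonglongrightarrow> snd l"
    using tendsto_fst [OF r(2)] tendsto_snd [OF r(2)] by (simp_all add: o_def)
  from tendsto_diff [OF ab(2,1)] have b: "(\<lambda>j. b (r j)) \<longlonglongrightarrow> snd l - fst l"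
    by simp
  have "g \<xi> = exp_curve (fst l + (snd l - fst l) * \<xi>)" for \<xi>
  proof (rule LIMSEQ_unique)
    show "(\<lambda>j. exp_curve (a (r j) + b (r j) * \<xi>)) \<longlonglongrightarrow> g \<xi>"
      using LIMSEQ_subseq_LIMSEQ [OF lim r(1)] by (simp add: o_def)
    show "(\<lambda>j. exp_curve (a (r j) + b (r j) * \<xi>)) \<longlonglongrightarrow> exp_curve (fst l + (snd l - fst l) * \<xi>)"
      by (intro tendsto_exp_curve tendsto_intros ab(1) b)
  qed
  then show ?thesis
    using that by blast
qed

section \<open>Unbounded speed of the curve\<close>

lemma fs_speed_exp_curve_ge:
  fixes t :: real
  assumes "t \<ge> 0" "a + b * \<xi> = of_real t * (- 1 + \<i>)"
  shows "fs_speed (\<lambda>\<zeta>. exp_curve (a + b * \<zeta>)) \<xi> \<ge> 2 * cmod b * t / 3"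
proof -
  define z where "z = a + b * \<xi>"
  let ?F = "\<lambda>\<zeta>. exp_lift (a + b * \<zeta>)"
  have "((\<lambda>\<zeta>. exp ((a + b * \<zeta>)\<^sup>2)) has_field_derivative 2 * b * z * exp (z\<^sup>2)) (at \<xi>)"
    unfolding z_def by (auto intro!: derivative_eq_intros)
  then have deriv: "vderiv ?F \<xi> $ 1 = 0" "vderiv ?F \<xi> $ 3 = 2 * b * z * exp (z\<^sup>2)"
    by (simp_all add: vderiv_def DERIV_imp_deriv)
  have Re: "Re z = - t" "Im z = t" "Re (z\<^sup>2) = 0"
    using assms by (simp_all add: z_def power2_eq_square)
  have "t \<le> cmod z"
    using abs_Im_le_cmod [of z] Re by simp
  \<comment> \<open>The 3 bounds the squared norm of the lift: Re z = -t is nonpositive and z^2 is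
    purely imaginary, so each coordinate has modulus at most 1.\<close>
  have "2 * cmod b * t / 3 \<le> 2 * cmod b * cmod z / (norm (exp_lift z))\<^sup>2"
    using \<open>t \<le> cmod z\<close> assms(1) Re
    by (intro frac_le mult_left_mono) (auto simp: norm_exp_lift add_pos_pos)
  also have "\<dots> \<le> fs_norm (?F \<xi>) (vderiv ?F \<xi>)"
    using fs_norm_ge [of "?F \<xi>" "vderiv ?F \<xi>"] Re
    by (simp add: deriv norm_mult flip: z_def)
  also have "\<dots> = fs_speed (\<lambda>\<zeta>. exp_curve (a + b * \<zeta>)) \<xi>"
    by (rule fs_speed_eq [symmetric, OF open_UNIV UNIV_I])
      (simp add: holomorphic_lift_exp_curve)
  finally show ?thesis .
qed

lemma not_FS_Brody_curve_exp_curve: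
  assumes "b \<noteq> 0"
  shows "\<not> FS_Brody_curve X (\<lambda>\<xi>. exp_curve (a + b * \<xi>))"
proof
  assume "FS_Brody_curve X (\<lambda>\<xi>. exp_curve (a + b * \<xi>))"
  then obtain B where B: "\<And>\<xi>. \<bar>fs_speed (\<lambda>\<zeta>. exp_curve (a + b * \<zeta>)) \<xi>\<bar> \<le> B"
    by (auto simp: FS_Brody_curve_def bounded_iff)
  \<comment> \<open>With this t the lower bound for the speed equals |B| + 1, and \<xi> is the
    parameter at which the curve reaches the corresponding point of the ray.\<close>
  define t where "t = 3 * (\<bar>B\<bar> + 1) / (2 * cmod b)"
  define \<xi> where "\<xi> = (of_real t * (- 1 + \<i>) - a) / b"
  have "2 * cmod b * t / 3 \<le> fs_speed (\<lambda>\<zeta>. exp_curve (a + b * \<zeta>)) \<xi>"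
    using assms by (intro fs_speed_exp_curve_ge) (auto simp: t_def \<xi>_def)
  also have "\<dots> \<le> B"
    using B [of \<xi>] by linarith
  finally show False
    using assms by (simp add: t_def)
qed

section \<open>Evaluation in the compact-open topology\<close>

lemma topspace_compact_open [simp]: "topspace (compact_open A X) = Hol A X"
proof -
  have "Hol A X \<in> {{f \<in> Hol A X. f ` K \<subseteq> U} | K U. compact K \<and> K \<subseteq> A \<and> open U}"
    by (auto intro!: exI [of _ "{}"])
  then show ?thesis
    unfolding compact_open_def topology_generated_by_topspace by blast
qed

lemma continuous_map_eval_compact_open:
  assumes "z \<in> A"
  shows "continuous_map (compact_open A X) euclidean (\<lambda>f. f z)"
proof (unfold continuous_map_def, intro conjI allI impI)
  fix U :: "'a cproj set"
  assume "openin euclidean U"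
  then have "{f \<in> Hol A X. f z \<in> U} \<in>
      {{f \<in> Hol A X. f ` K \<subseteq> U} | K U. compact K \<and> K \<subseteq> A \<and> open U}"
    using assms by (auto intro!: exI [of _ "{z}"] exI [of _ U])
  then show "openin (compact_open A X) {f \<in> topspace (compact_open A X). f z \<in> U}"
    unfolding topspace_compact_open unfolding compact_open_def
    by (rule topology_generated_by_Basis)
qed simp

text \<open>Evaluation at z is continuous because singletons are compact, so it maps the compact
  closure of the family onto a compact set. The closure is taken inside \<open>Hol A X\<close>,
  which keeps that set in X.\<close>

lemma normal_family_eval:
  assumes "normal_family A X \<F>" "\<F> \<subseteq> Hol A X" "z \<in> A"
  obtains L where "compact L" "L \<subseteq> X" "\<And>f. f \<in> \<F> \<Longrightarrow> f z \<in> L"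
proof
  let ?C = "compact_open A X closure_of \<F>"
  show "compact ((\<lambda>f. f z) ` ?C)"
    using image_compactin [OF assms(1) [unfolded normal_family_def]
        continuous_map_eval_compact_open [OF assms(3)]] by simp
  show "(\<lambda>f. f z) ` ?C \<subseteq> X"
    using closure_of_subset_topspace [of "compact_open A X" \<F>] assms(3) by (auto simp: Hol_def)
  show "f z \<in> (\<lambda>f. f z) ` ?C" if "f \<in> \<F>" for f
    using that closure_of_subset [of \<F> "compact_open A X"] assms(2) by auto
qed

section \<open>The family of dilated curves and the contradiction\<close>

definition exp_map :: "nat \<Rightarrow> complex \<Rightarrow> 3 cproj" where
  "exp_map n = restrict (\<lambda>z. exp_curve (of_nat n * z)) (ball 0 1)"

lemma exp_map_in_Hol: "exp_map n \<in> Hol (ball 0 1) torus2"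
proof -
  have "holomorphic_lift (exp_map n) (ball 0 1) (\<lambda>z. exp_lift (0 + of_nat n * z))"
    by (rule holomorphic_lift_exp_curve) (simp add: exp_map_def)
  then have "proj_holomorphic_on (exp_map n) (ball 0 1)"
    unfolding proj_holomorphic_on_def by blast
  then show ?thesis
    by (auto simp: Hol_def exp_map_def exp_curve_in_torus2)
qed

lemma not_normal_exp_map: "\<not> normal_family (ball 0 1) torus2 (range exp_map)"
proof
  assume "normal_family (ball 0 1) torus2 (range exp_map)"
  then obtain L where L: "compact L" "L \<subseteq> torus2" "\<And>f. f \<in> range exp_map \<Longrightarrow> f (1/2) \<in> L"
    by (rule normal_family_eval [where z = "1/2"]) (auto simp: exp_map_in_Hol)
  obtain R where R: "\<And>z. exp_curve z \<in> L \<Longrightarrow> cmod z \<le> R"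
    using exp_curve_proper [OF L(1,2)] by blast
  have "real n / 2 \<le> R" for n
    using R [of "of_nat n / 2"] L(3) [of "exp_map n"] by (simp add: exp_map_def norm_divide)
  moreover obtain n :: nat where "2 * R < real n"
    using reals_Archimedean2 by blast
  ultimately show False
    by (metis field_sum_of_halves mult_2 not_le mult.commute divide_le_eq_numeral1(1))
qed

lemma not_compactly_divergent_exp_map:
  assumes "range f \<subseteq> range exp_map"
  shows "\<not> compactly_divergent (ball 0 1) torus2 f"
proof
  assume "compactly_divergent (ball 0 1) torus2 f"
  then obtain j0 where "\<And>j. j \<ge> j0 \<Longrightarrow> f j ` {0} \<inter> {exp_curve 0} = {}"
    unfolding compactly_divergent_def
    by (metis compact_sing exp_curve_in_torus2 empty_subsetI insert_subset centre_in_ball zero_less_one)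
  moreover obtain n where "f j0 = exp_map n"
    using assms by blast
  ultimately show False
    by (force simp: exp_map_def)
qed

theorem theorem1p7:
  shows "\<not> FS_limit_type torus2"
proof
  assume "FS_limit_type torus2"
  moreover have "range exp_map \<subseteq> Hol (ball 0 1) torus2"
    using exp_map_in_Hol by blast
  ultimately obtain p :: "nat \<Rightarrow> complex" and p0 f and \<rho> :: "nat \<Rightarrow> real" and g where
    p: "p0 \<in> ball 0 1" "p \<longlonglongrightarrow> p0" and f: "range f \<subseteq> range exp_map" and \<rho>: "\<rho> \<longlonglongrightarrow> 0"
    and lim: "\<And>K. compact K \<Longrightarrow>
      uniform_limit K (\<lambda>j \<xi>. f j (p j + complex_of_real (\<rho> j) * \<xi>)) g sequentially"
    and g: "FS_Brody_curve torus2 g" "\<not> g constant_on UNIV"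
    unfolding FS_limit_type_def
    using not_normal_exp_map not_compactly_divergent_exp_map by meson
  have "\<exists>n. \<forall>j. f j = exp_map (n j)"
    using f by (intro choice) blast
  then obtain n where n: "\<And>j. f j = exp_map (n j)"
    by blast
  have "(\<lambda>j. exp_curve (of_nat (n j) * p j + of_nat (n j) * of_real (\<rho> j) * \<xi>)) \<longlonglongrightarrow> g \<xi>" for \<xi>
  proof -
    \<comment> \<open>\<open>exp_map\<close> is \<open>undefined\<close> off the disc, so the affine
      formula for \<open>f j\<close> holds only once the argument has entered the disc, which
      happens for large j because p0 is an interior point.\<close>
    have "(\<lambda>j. p j + of_real (\<rho> j) * \<xi>) \<longlonglongrightarrow> p0 + of_real 0 * \<xi>"
      by (intro tendsto_intros p \<rho>)
    then have "\<forall>\<^sub>F j in sequentially. p j + of_real (\<rho> j) * \<xi> \<in> ball 0 1"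
      using p by (intro topological_tendstoD) auto
    then have "\<forall>\<^sub>F j in sequentially. f j (p j + of_real (\<rho> j) * \<xi>) =
        exp_curve (of_nat (n j) * p j + of_nat (n j) * of_real (\<rho> j) * \<xi>)"
      by eventually_elim (simp add: n exp_map_def algebra_simps)
    \<comment> \<open>One-point compact sets suffice, since only pointwise convergence is needed to
      identify g.\<close>
    moreover have "(\<lambda>j. f j (p j + of_real (\<rho> j) * \<xi>)) \<longlonglongrightarrow> g \<xi>"
      using tendsto_uniform_limitI [OF lim [of "{\<xi>}"]] by simp
    ultimately show ?thesis
      using tendsto_cong by fast
  qed
  moreover have "range g \<subseteq> torus2"
    using g(1) by (auto simp: FS_Brody_curve_def Hol_def)
  ultimately obtain a b where ab: "g = (\<lambda>\<xi>. exp_curve (a + b * \<xi>))"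
    by (rule limit_of_rescaled_exp_curve)
  with g(2) have "b \<noteq> 0"
    by (auto simp: constant_on_def)
  then show False
    using g(1) not_FS_Brody_curve_exp_curve ab by blast
qed

end
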